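(* Let $N\ge1$, let $u$ be a polynomial of degree at most $N+1$, let $x_1<\dots<x_N$ be the roots of the Legendre polynomial $L_N$, and let $u_N$ be the polynomial of degree at most $N$ with $u_N(-1)=u(-1)$ and $u_N'(x_k)=u'(x_k)$ for $k=1,\dots,N$. Then there is a constant $c$ such that for all $x$ $$(u-u_N)(x) = c\int_{-1}^x L_N(t)\, dt = \frac{c}{2N+1} (L_{N+1}-L_{N-1})(x) = c\,\frac{x^2-1}{N(N+1)}L_N'(x).$$
   Context: $L_n$ denotes the Legendre polynomial of degree $n$ on $[-1,1]$, normalized by $L_n(1)=1$. *)

theory Defs
  imports "HOL-Analysis.Analysis" "HOL-Computational_Algebra.Polynomial"
begin

definition is_legendre :: "nat \<Rightarrow> real poly \<Rightarrow> bool" where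
  "is_legendre n p \<longleftrightarrow>
     degree p = n \<and>
     (\<forall>q. degree q < n \<longrightarrow> (LBINT t=ereal (-1)..ereal 1. poly p t * poly q t) = 0) \<and>
     poly p 1 = 1"

definition legendre :: "nat \<Rightarrow> real poly" where
  "legendre n = (THE p. is_legendre n p)"

definition legendre_ip :: "real poly \<Rightarrow> real poly \<Rightarrow> real" where
  "legendre_ip p q = integral {-1..1} (\<lambda>t. poly p t * poly q t)"

lemma legendre_ip_eq:
  "(LBINT t=ereal (-1)..ereal 1. poly p t * poly q t) = legendre_ip p q"
  unfolding legendre_ip_def
  by (intro interval_integral_eq_integral)
     (auto intro!: borel_integrable_atLeastAtMost' continuous_intros)

lemma legendre_ip_int: "(\<lambda>t. poly p t * poly q t) integrable_on {-1..1::real}"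
  by (intro integrable_continuous_interval continuous_intros)

lemma legendre_ip_diff: "legendre_ip (p - q) r = legendre_ip p r - legendre_ip q r"
  unfolding legendre_ip_def
  by (simp add: left_diff_distrib Henstock_Kurzweil_Integration.integral_diff legendre_ip_int)

lemma legendre_ip_smult: "legendre_ip (smult c p) r = c * legendre_ip p r"
  unfolding legendre_ip_def by (simp add: mult.assoc)

lemma legendre_ip_add_right: "legendre_ip p (q + r) = legendre_ip p q + legendre_ip p r"
  unfolding legendre_ip_def
  by (simp add: distrib_left Henstock_Kurzweil_Integration.integral_add legendre_ip_int)

lemma legendre_ip_commute: "legendre_ip p q = legendre_ip q p"
  unfolding legendre_ip_def by (simp add: mult.commute)

lemma poly_zero_on_interval:
  fixes p :: "real poly"
  assumes "\<And>t. \<lbrakk>-1 < t; t < 1\<rbrakk> \<Longrightarrow> poly p t = 0"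
  shows "p = 0"
proof (rule ccontr)
  assume "p \<noteq> 0"
  then have "finite {t. poly p t = 0}" by (rule poly_roots_finite)
  moreover have "{-1<..<1} \<subseteq> {t. poly p t = 0}" using assms by auto
  ultimately show False
    using infinite_Ioo[of "-1::real" 1] finite_subset by (metis less_trans neg_less_0_iff_less zero_less_one)
qed

lemma weighted_integral_0:
  fixes p w :: "real poly"
  assumes "\<And>t. \<lbrakk>-1 < t; t < 1\<rbrakk> \<Longrightarrow> poly w t > 0" "\<And>t. \<lbrakk>-1 \<le> t; t \<le> 1\<rbrakk> \<Longrightarrow> poly w t \<ge> 0"
    and "legendre_ip (w * p) p = 0"
  shows "p = 0"
proof (rule poly_zero_on_interval)
  fix t :: real assume t: "-1 < t" "t < 1"
  have "((\<lambda>t. poly (w * p) t * poly p t) has_integral 0) (cbox (-1) 1)"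
    using integrable_integral[OF legendre_ip_int[of "w * p" p]] assms(3)
    by (simp add: legendre_ip_def)
  then have "poly (w * p) t * poly p t = 0"
    by (rule has_integral_0_cbox_imp_0[rotated 2])
       (use t assms(2) in \<open>auto intro!: continuous_intros simp: mult.assoc\<close>)
  then show "poly p t = 0" using assms(1)[OF t] by auto
qed

lemma legendre_ip_self_0: "legendre_ip p p = 0 \<Longrightarrow> p = 0"
  using weighted_integral_0[of 1 p] by simp

lemma orthogonal_poly_exists:
  "\<exists>p. degree p = n \<and> p \<noteq> 0 \<and> (\<forall>q. degree q < n \<longrightarrow> legendre_ip p q = 0)"
proof (induction n rule: less_induct)
  case (less n)
  have "\<exists>p. degree p = n \<and> p \<noteq> 0 \<and> (\<forall>q. (q = 0 \<or> degree q < m) \<longrightarrow> legendre_ip p q = 0)"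
    if "m \<le> n" for m
    using that
  proof (induction m)
    case 0
    show ?case
      by (rule exI[of _ "monom 1 n"]) (auto simp: degree_monom_eq legendre_ip_def monom_eq_0_iff)
  next
    case (Suc m)
    then obtain p where p: "degree p = n" "p \<noteq> 0"
      "\<And>q. q = 0 \<or> degree q < m \<Longrightarrow> legendre_ip p q = 0" by auto
    obtain r where r: "degree r = m" "r \<noteq> 0" "\<And>q. degree q < m \<Longrightarrow> legendre_ip r q = 0"
      using less.IH[of m] Suc.prems by auto
    have rr: "legendre_ip r r \<noteq> 0" using legendre_ip_self_0 r by blast
    define s where "s = p - smult (legendre_ip p r / legendre_ip r r) r"
    have "coeff r n = 0" using r(1) Suc.prems by (intro coeff_eq_0) simp
    moreover have "coeff p n \<noteq> 0" using p(1,2) leading_coeff_0_iff[of p] by simp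
    ultimately have coeff: "coeff s n \<noteq> 0" unfolding s_def by simp
    have "degree s \<le> n" unfolding s_def using r(1) p(1) Suc.prems
      by (intro degree_diff_le) (auto intro: order_trans[OF degree_smult_le])
    with le_degree[OF coeff] have ds: "degree s = n" by simp
    have ip0: "legendre_ip s q = 0" if "q = 0 \<or> degree q < m" for q
    proof (cases "q = 0")
      case True
      then show ?thesis by (simp add: legendre_ip_def)
    next
      case False
      then show ?thesis
        using that p(3) r(3) by (simp add: s_def legendre_ip_diff legendre_ip_smult)
    qed
    have ipr: "legendre_ip s r = 0" using rr by (simp add: s_def legendre_ip_diff legendre_ip_smult)
    have "legendre_ip s q = 0" if q: "q = 0 \<or> degree q < Suc m" for q
    proof -
      define c where "c = coeff q m / coeff r m"
      have cr: "coeff r m \<noteq> 0" using r by auto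
      define q' where "q' = q - smult c r"
      have "degree q' \<le> m" using q r unfolding q'_def
        by (intro degree_diff_le) (auto intro: order_trans[OF degree_smult_le])
      moreover have "coeff q' m = 0" using cr by (simp add: q'_def c_def)
      ultimately have "q' = 0 \<or> degree q' < m"
        using eq_zero_or_degree_less by blast
      then have "legendre_ip s q' = 0" by (rule ip0)
      moreover have "q = q' + smult c r" by (simp add: q'_def)
      moreover have "legendre_ip s (smult c r) = 0"
        using ipr by (simp add: legendre_ip_commute[of s] legendre_ip_smult)
      ultimately show ?thesis by (simp only: legendre_ip_add_right)
    qed
    then show ?case using ds coeff by (intro exI[of _ s]) auto
  qed
  from this[of n] show ?case by auto
qed

text \<open>The definite description in \<^const>\<open>legendre\<close> is well-defined.\<close>

lemma ex1_is_legendre: "\<exists>!p. is_legendre n p"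
proof -
  obtain p where p: "degree p = n" "p \<noteq> 0" "\<And>q. degree q < n \<Longrightarrow> legendre_ip p q = 0"
    using orthogonal_poly_exists by blast
  have p1: "poly p 1 \<noteq> 0"
  proof
    assume "poly p 1 = 0"
    then obtain q where q: "p = [:-1, 1:] * q"
      by (auto simp: poly_eq_0_iff_dvd elim: dvdE)
    then have "q \<noteq> 0" using p by auto
    then have "degree q < n" using p(1) unfolding q by (subst (asm) degree_mult_eq) auto
    then have "legendre_ip p q = 0" using p by blast
    moreover have "[:1, -1:] * q = smult (-1) p" using q by simp
    ultimately have "legendre_ip ([:1, -1:] * q) q = 0" by (simp only: legendre_ip_smult mult_zero_right)
    then have "q = 0" by (intro weighted_integral_0[of "[:1,-1:]" q]) auto
    then show False using \<open>q \<noteq> 0\<close> by blast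
  qed
  have L: "is_legendre n (smult (1 / poly p 1) p)"
    unfolding is_legendre_def legendre_ip_eq legendre_ip_smult using p p1 by simp
  have "r = s" if r: "is_legendre n r" and s: "is_legendre n s" for r s
  proof -
    define d where "d = smult (coeff s n) r - smult (coeff r n) s"
    have o: "legendre_ip d q = 0" if "degree q < n" for q
      using r s that unfolding d_def legendre_ip_diff legendre_ip_smult is_legendre_def legendre_ip_eq by simp
    have "degree d \<le> n" using r s unfolding d_def is_legendre_def
      by (intro degree_diff_le) (auto intro: order_trans[OF degree_smult_le])
    moreover have "coeff d n = 0" by (simp add: d_def)
    ultimately have "d = 0 \<or> degree d < n" using eq_zero_or_degree_less by blast
    then have "d = 0" using o legendre_ip_self_0 by blast
    then have e: "smult (coeff s n) r = smult (coeff r n) s" by (simp add: d_def)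
    then have "poly (smult (coeff s n) r) 1 = poly (smult (coeff r n) s) 1" by simp
    then have "coeff s n = coeff r n" using r s by (simp add: is_legendre_def)
    moreover have "coeff s n \<noteq> 0" using s
      unfolding is_legendre_def using leading_coeff_0_iff[of s] by auto
    ultimately show ?thesis using e by (simp add: poly_eq_iff)
  qed
  with L show ?thesis by blast
qed

lemma is_legendre_legendre: "is_legendre n (legendre n)"
  unfolding legendre_def by (rule theI'[OF ex1_is_legendre])

end

theory Submission
  imports Defs
begin

text \<open>
  Every degree-\<open>n\<close> polynomial orthogonal to all polynomials of smaller degree is a multiple of
  \<open>L\<^sub>n\<close>. Integration by parts shows that \<open>((x\<^sup>2 - 1) L\<^sub>N')'\<close> and \<open>(L\<^sub>N\<^sub>+\<^sub>1 - L\<^sub>N\<^sub>-\<^sub>1)'\<close> are of this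
  kind; the factors \<open>N(N + 1)\<close> and \<open>2N + 1\<close> come from comparing leading coefficients and from
  evaluating at \<open>1\<close> with \<open>L\<^sub>n'(1) = n(n + 1)/2\<close>. Since \<open>(u - u\<^sub>N)'\<close> has degree at most \<open>N\<close> and
  vanishes at the \<open>N\<close> roots of \<open>L\<^sub>N\<close>, it is a multiple of \<open>L\<^sub>N\<close> too, and all the functions in question
  vanish at \<open>-1\<close>.
\<close>

lemma degree_legendre [simp]: "degree (legendre n) = n"
  and poly_legendre_1 [simp]: "poly (legendre n) 1 = 1"
  and legendre_ip_legendre: "degree q < n \<Longrightarrow> legendre_ip (legendre n) q = 0"
  using is_legendre_legendre[of n] by (auto simp: is_legendre_def legendre_ip_eq)

lemma coeff_legendre_neq_0: "coeff (legendre n) n \<noteq> 0"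
proof -
  have "legendre n \<noteq> 0" using poly_legendre_1[of n] by force
  then show ?thesis using leading_coeff_0_iff[of "legendre n"] by simp
qed

lemma legendre_ip_0 [simp]: "legendre_ip p 0 = 0"
  by (simp add: legendre_ip_def)

lemma legendre_ip_pderiv:
  "legendre_ip (pderiv p) q =
     poly p 1 * poly q 1 - poly p (-1) * poly q (-1) - legendre_ip p (pderiv q)"
proof -
  have "((\<lambda>t. poly (pderiv (p * q)) t) has_integral poly (p * q) 1 - poly (p * q) (-1)) {-1..1}"
    by (rule fundamental_theorem_of_calculus)
       (auto simp: has_real_derivative_iff_has_vector_derivative[symmetric] simp del: poly_mult
             intro: DERIV_subset[OF poly_DERIV])
  moreover have "((\<lambda>t. poly (pderiv (p * q)) t) has_integral
      legendre_ip p (pderiv q) + legendre_ip (pderiv p) q) {-1..1}"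
    unfolding legendre_ip_def pderiv_mult poly_add
    using has_integral_add[OF integrable_integral[OF legendre_ip_int[of p "pderiv q"]]
        integrable_integral[OF legendre_ip_int[of "pderiv p" q]]]
    by (simp add: mult.commute)
  ultimately have "poly (p * q) 1 - poly (p * q) (-1) =
      legendre_ip p (pderiv q) + legendre_ip (pderiv p) q"
    by (rule has_integral_unique)
  then show ?thesis by simp
qed

text \<open>The zero case stands apart because \<open>degree 0 = 0\<close> is not below
  \<open>n\<close> when \<open>n = 0\<close>.\<close>

lemma diff_smult_cancel_top:
  fixes p r :: "'a::field poly"
  assumes "degree p \<le> n" "degree r \<le> n" "coeff r n \<noteq> 0"
  shows "p - smult (coeff p n / coeff r n) r = 0
    \<or> degree (p - smult (coeff p n / coeff r n) r) < n"
proof -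
  have "degree (p - smult (coeff p n / coeff r n) r) \<le> n"
    using assms by (intro degree_diff_le order_trans[OF degree_smult_le])
  moreover have "coeff (p - smult (coeff p n / coeff r n) r) n = 0"
    using assms by simp
  ultimately show ?thesis using eq_zero_or_degree_less by blast
qed

text \<open>Cancelling the leading term leaves a remainder that is orthogonal to all lower degrees,
  hence to itself, hence zero. The factor is read off at 1.\<close>

lemma orthogonal_eq_smult_legendre:
  assumes deg: "degree p \<le> n" and orth: "\<And>q. degree q < n \<Longrightarrow> legendre_ip p q = 0"
  shows "p = smult (poly p 1) (legendre n)"
proof -
  define c where "c = coeff p n / coeff (legendre n) n"
  define d where "d = p - smult c (legendre n)"
  have "d = 0 \<or> degree d < n"
    unfolding d_def c_def using deg coeff_legendre_neq_0 by (intro diff_smult_cancel_top) auto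
  moreover have "legendre_ip d q = 0" if "degree q < n" for q
    using that orth legendre_ip_legendre by (simp add: d_def legendre_ip_diff legendre_ip_smult)
  ultimately have "d = 0" using legendre_ip_self_0 by blast
  then have "p = smult c (legendre n)" by (simp add: d_def)
  then show ?thesis by simp
qed

lemma legendre_ip_reflect:
  "legendre_ip (pcompose p [:0, -1:]) q = legendre_ip p (pcompose q [:0, -1:])"
  using Henstock_Kurzweil_Integration.integral_reflect_real[of 1 "-1" "\<lambda>t. poly p t * poly q (- t)"]
  by (simp add: legendre_ip_def poly_pcompose)

lemma coeff_pcompose_neg: "coeff (pcompose p [:0, -1:]) n = (-1) ^ n * coeff p n"
  for p :: "real poly"
  using coeff_pcompose_linear[of p "-1" n] by simp

text \<open>Orthogonality survives t -> -t, so the reflected polynomial is a multiple of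
  \<open>legendre n\<close>, with factor its value at 1. Leading coefficients show that this factor
  is (-1)^n.\<close>

lemma poly_legendre_minus_1: "poly (legendre n) (-1) = (-1) ^ n"
proof -
  let ?p = "pcompose (legendre n) [:0, -1:]"
  have "?p = smult (poly ?p 1) (legendre n)"
    by (rule orthogonal_eq_smult_legendre) (auto simp: legendre_ip_reflect legendre_ip_legendre degree_pcompose)
  then have "coeff ?p n = poly ?p 1 * coeff (legendre n) n"
    by (metis coeff_smult)
  then show ?thesis
    using coeff_legendre_neq_0[of n] by (simp add: coeff_pcompose_neg poly_pcompose)
qed

lemma degree_pderiv_less: "pderiv q = 0 \<or> degree (pderiv q) < degree q"
  for q :: "real poly"
  by (metis degree_pderiv diff_less less_one neq0_conv pderiv_eq_0_iff)

lemma degree_sturm_liouville: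
  "degree (pderiv ([:-1, 0, 1:] * pderiv q)) \<le> degree q" for q :: "real poly"
proof -
  have "degree ([:-1, 0, 1:] * pderiv q) \<le> degree q + 1"
  proof (cases "degree q = 0")
    case True
    then show ?thesis by (simp add: pderiv_eq_0_iff[THEN iffD2])
  next
    case False
    then show ?thesis
      using degree_mult_le[of "[:-1, 0, 1:]" "pderiv q"] by (simp add: degree_pderiv)
  qed
  then show ?thesis by (simp add: degree_pderiv)
qed

lemma coeff_sturm_liouville:
  "coeff (pderiv ([:-1, 0, 1:] * pderiv q)) (degree q) =
     real (degree q) * (real (degree q) + 1) * coeff q (degree q)"
proof (cases "degree q")
  case 0
  then show ?thesis by (simp add: pderiv_eq_0_iff[THEN iffD2])
next
  case (Suc n)
  \<comment> \<open>The summand -1 of x^2 - 1 contributes this coefficient, two above the degree of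
    \<open>q\<close>.\<close>
  have "coeff q (Suc (Suc (Suc n))) = 0" using Suc by (intro coeff_eq_0) simp
  then show ?thesis
    by (simp add: Suc coeff_pderiv coeff_pCons split: nat.split)
qed

theorem legendre_sturm_liouville:
  "pderiv ([:-1, 0, 1:] * pderiv (legendre n)) = smult (real n * (real n + 1)) (legendre n)"
    (is "?g = _")
proof -
  have orth: "legendre_ip ?g q = 0" if "degree q < n" for q
  proof -
    \<comment> \<open>Two integrations by parts move the operator onto \<open>q\<close>, whose
      degree it does not raise. Both boundary terms vanish with x^2 - 1 at 1 and -1.\<close>
    have "legendre_ip ?g q = - legendre_ip ([:-1, 0, 1:] * pderiv (legendre n)) (pderiv q)"
      by (subst legendre_ip_pderiv) simp
    also have "\<dots> = - legendre_ip (pderiv (legendre n)) ([:-1, 0, 1:] * pderiv q)"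
      by (simp add: legendre_ip_def algebra_simps)
    also have "\<dots> = legendre_ip (legendre n) (pderiv ([:-1, 0, 1:] * pderiv q))"
      by (subst legendre_ip_pderiv) simp
    also have "\<dots> = 0"
      using degree_sturm_liouville[of q] that by (intro legendre_ip_legendre) linarith
    finally show ?thesis .
  qed
  have "?g = smult (poly ?g 1) (legendre n)"
    using degree_sturm_liouville[of "legendre n"] orth
    by (intro orthogonal_eq_smult_legendre) simp_all
  moreover from this have "coeff ?g n = poly ?g 1 * coeff (legendre n) n"
    by (metis coeff_smult)
  then have "poly ?g 1 = real n * (real n + 1)"
    using coeff_sturm_liouville[of "legendre n"] coeff_legendre_neq_0[of n] by simp
  ultimately show ?thesis by simp
qed

text \<open>At 1 the second-order term of the differential equation drops out, leaving 2 L_n'(1) =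
  n(n + 1).\<close>

lemma poly_pderiv_legendre_1: "poly (pderiv (legendre n)) 1 = real n * (real n + 1) / 2"
proof -
  have "poly (pderiv ([:-1, 0, 1:] * pderiv (legendre n))) 1 = real n * (real n + 1)"
    by (simp only: legendre_sturm_liouville poly_smult poly_legendre_1 mult_1_right)
  then show ?thesis by (simp add: pderiv_mult pderiv_pCons del: mult_pCons_left)
qed

theorem pderiv_legendre_diff:
  assumes "n \<ge> 1"
  shows "pderiv (legendre (n + 1) - legendre (n - 1)) = smult (2 * real n + 1) (legendre n)"
    (is "pderiv ?D = _")
proof -
  \<comment> \<open>The indices \<open>n + 1\<close> and \<open>n - 1\<close> have equal parity. As
    \<open>?D\<close> also vanishes at 1, integration by parts leaves no boundary terms.\<close>
  have minus1: "poly ?D (-1) = 0"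
    using assms by (cases n) (auto simp: poly_legendre_minus_1)
  have orth: "legendre_ip (pderiv ?D) q = 0" if "degree q < n" for q
  proof -
    have "pderiv q = 0 \<or> degree (pderiv q) < n - 1"
      using degree_pderiv_less[of q] that by linarith
    then have "legendre_ip ?D (pderiv q) = 0"
      by (auto simp: legendre_ip_diff legendre_ip_legendre)
    then show ?thesis
      using minus1 by (subst legendre_ip_pderiv) simp
  qed
  have "degree ?D \<le> n + 1" by (intro degree_diff_le) simp_all
  then have "pderiv ?D = smult (poly (pderiv ?D) 1) (legendre n)"
    by (intro orthogonal_eq_smult_legendre orth) (auto simp: degree_pderiv)
  \<comment> \<open>(n + 1)(n + 2)/2 - (n - 1)n/2 = 2n + 1.\<close>
  moreover have "poly (pderiv ?D) 1 = 2 * real n + 1"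
    using assms by (simp add: pderiv_diff poly_pderiv_legendre_1 of_nat_diff field_simps)
  ultimately show ?thesis by simp
qed

text \<open>No order of \<open>a\<close> and \<open>b\<close> is assumed: the integral is oriented,
  so the final identities also cover x < -1.\<close>

lemma interval_integral_pderiv:
  "(LBINT t=ereal a..ereal b. poly (pderiv p) t) = poly p b - poly p a"
  by (rule interval_integral_FTC_finite)
     (auto simp: has_real_derivative_iff_has_vector_derivative[symmetric]
           intro!: continuous_intros intro: DERIV_subset[OF poly_DERIV])

text \<open>After cancelling the top coefficient, a nonzero difference would have degree below
  \<open>n\<close> but \<open>n\<close> distinct roots.\<close>

lemma poly_eq_smult_if_common_roots:
  fixes p r :: "real poly"
  assumes "degree p \<le> n" "degree r \<le> n" "coeff r n \<noteq> 0"
    and "card {t. poly r t = 0} = n" and "\<And>t. poly r t = 0 \<Longrightarrow> poly p t = 0"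
  shows "\<exists>c. p = smult c r"
proof -
  define d where "d = p - smult (coeff p n / coeff r n) r"
  have d: "d = 0 \<or> degree d < n"
    unfolding d_def using assms by (intro diff_smult_cancel_top)
  have "d = 0"
  proof (rule ccontr)
    assume "d \<noteq> 0"
    then have "card {t. poly r t = 0} \<le> card {t. poly d t = 0}"
      using assms(5) by (intro card_mono poly_roots_finite) (auto simp: d_def)
    also have "\<dots> \<le> degree d" using \<open>d \<noteq> 0\<close> by (rule card_poly_roots_bound)
    finally show False using d \<open>d \<noteq> 0\<close> assms(4) by simp
  qed
  then show ?thesis by (auto simp: d_def)
qed

theorem theorem3p1:
  fixes N :: nat and u uN :: "real poly" and \<xi> :: "nat \<Rightarrow> real"
  assumes "N \<ge> 1"
    and "degree u \<le> N + 1"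
    and "strict_mono_on {1..N} \<xi>"
    and "\<xi> ` {1..N} = {t. poly (legendre N) t = 0}"
    and "degree uN \<le> N"
    and "poly uN (-1) = poly u (-1)"
    and "\<And>k. k \<in> {1..N} \<Longrightarrow> poly (pderiv uN) (\<xi> k) = poly (pderiv u) (\<xi> k)"
  shows "\<exists>c::real. \<forall>x::real.
      poly u x - poly uN x = c * (LBINT t=ereal (-1)..ereal x. poly (legendre N) t) \<and>
      c * (LBINT t=ereal (-1)..ereal x. poly (legendre N) t)
        = c / (2 * real N + 1) * (poly (legendre (N + 1)) x - poly (legendre (N - 1)) x) \<and>
      c / (2 * real N + 1) * (poly (legendre (N + 1)) x - poly (legendre (N - 1)) x)
        = c * ((x\<^sup>2 - 1) / (real N * (real N + 1))) * poly (pderiv (legendre N)) x"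
proof -
  have "card {t. poly (legendre N) t = 0} = N"
    using card_image[OF strict_mono_on_imp_inj_on[OF assms(3)]] assms(4) by simp
  moreover have "poly (pderiv (u - uN)) t = 0" if t: "poly (legendre N) t = 0" for t
  proof -
    obtain k where "k \<in> {1..N}" "t = \<xi> k" using t assms(4) by blast
    then show ?thesis using assms(7) by (simp add: pderiv_diff)
  qed
  moreover have "degree (u - uN) \<le> N + 1" using assms(2,5) by (intro degree_diff_le) auto
  then have "degree (pderiv (u - uN)) \<le> N" by (simp add: degree_pderiv)
  ultimately obtain c where c: "pderiv (u - uN) = smult c (legendre N)"
    using poly_eq_smult_if_common_roots[of "pderiv (u - uN)" N "legendre N"]
      coeff_legendre_neq_0 by auto
  \<comment> \<open>Applied to three primitives of multiples of L_N. They vanish at -1 by the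
    condition on \<open>uN\<close>, by parity, and by the factor x^2 - 1, respectively.\<close>
  have integral: "poly p x - poly p (-1) = a * (LBINT t=ereal (-1)..ereal x. poly (legendre N) t)"
    if "pderiv p = smult a (legendre N)" for p a x
    using interval_integral_pderiv[of "-1" x p] that by simp
  have "poly u x - poly uN x = c * (LBINT t=ereal (-1)..ereal x. poly (legendre N) t)" for x
    using integral[OF c] assms(6) by simp
  moreover have "poly (legendre (N + 1)) x - poly (legendre (N - 1)) x
      = (2 * real N + 1) * (LBINT t=ereal (-1)..ereal x. poly (legendre N) t)" for x
    using integral[OF pderiv_legendre_diff[OF assms(1)], of x] assms(1)
    by (cases N) (auto simp: poly_legendre_minus_1)
  moreover have "(x\<^sup>2 - 1) * poly (pderiv (legendre N)) x
      = real N * (real N + 1) * (LBINT t=ereal (-1)..ereal x. poly (legendre N) t)" for x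
    using integral[OF legendre_sturm_liouville, of x]
    by (simp add: power2_eq_square algebra_simps)
  moreover have "2 * real N + 1 \<noteq> 0" "real N * (real N + 1) \<noteq> 0" using assms(1) by auto
  ultimately show ?thesis
    by (intro exI[of _ c] allI) (simp add: mult.assoc)
qed

end
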